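(* Let $G^\sigma$ be a connected signed graph of order $n\ge 3$ that contains a cycle, let $g(G^\sigma)$ be its girth, and assume $g(G^\sigma)<n$. Then for any real eigenvalue $\lambda$ of the adjacency matrix $A(G^\sigma)$, \[ m(G^\sigma,\lambda)\le n-g(G^\sigma)+2, \] and equality holds if and only if one of the following holds: (i) $G^\sigma$ is a balanced complete signed graph $K_n^\sigma$ and $\lambda=-1$; (ii) $G^\sigma$ is an antibalanced complete signed graph $K_n^\sigma$ and $\lambda=1$; (iii) $G^\sigma$ is a balanced complete bipartite signed graph $K_{n_1,n_2}^\sigma$ with $n_1,n_2\ge 2$ and $\lambda=0$.
   Context: All graphs are finite, simple and undirected. A signed graph $G^\sigma=(G,\sigma)$ consists of an underlying graph $G=(V,E)$ and a sign function $\sigma:E\to\{+1,-1\}$. Its order is $n=|V|$. It is connected if $G$ is connected, and its girth $g(G^\sigma)$ is the length of a shortest cycle of $G$. The adjacency matrix $A(G^\sigma)=[a^\sigma_{ij}]$ is the real symmetric $n\times n$ matrix with $a^\sigma_{ij}=\sigma(v_iv_j)$ if $v_i$ and $v_j$ are adjacent and $a^\sigma_{ij}=0$ otherwise. $m(G^\sigma,\lambda)$ denotes the multiplicity of $\lambda$ as an eigenvalue of $A(G^\sigma)$, i.e. $m(G^\sigma,\lambda)=n-\operatorname{rank}(\lambda I-A(G^\sigma))$. The sign of a cycle is the product of the signs of its edges. $G^\sigma$ is balanced if every cycle has sign $+1$, and antibalanced if every even cycle has sign $+1$ and every odd cycle has sign $-1$. $K_n^\sigma$ (resp. $K_{n_1,n_2}^\sigma$)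 denotes a signed graph whose underlying graph is the complete graph $K_n$ (resp. the complete bipartite graph $K_{n_1,n_2}$, with $n_1+n_2=n$). *)

theory Defs
  imports "HOL-Analysis.Analysis"
begin

text \<open>The vertex set is the whole finite type \<open>'v\<close>, so the order of the graph is \<open>CARD('v)\<close>.
  Edges are two-element sets of vertices; values of the sign function off the edge set are never
  used.\<close>

locale signed_graph =
  fixes E :: "'v::finite set set" and \<sigma> :: "'v set \<Rightarrow> real"
  assumes edge_card: "e \<in> E \<Longrightarrow> card e = 2"
    and edge_sign: "e \<in> E \<Longrightarrow> \<sigma> e \<in> {1, -1}"

definition connected_graph :: "'v set set \<Rightarrow> bool" where
  "connected_graph E \<longleftrightarrow> (\<forall>u v. (u, v) \<in> {(x, y). {x, y} \<in> E}\<^sup>*)"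

text \<open>A cycle is given by the list of its vertices in cyclic order, without repeating the first
  vertex at the end; its length is the length of the list.\<close>

definition cycle_edge :: "'v list \<Rightarrow> nat \<Rightarrow> 'v set" where
  "cycle_edge c i = {c ! i, c ! (Suc i mod length c)}"

definition is_cycle :: "'v set set \<Rightarrow> 'v list \<Rightarrow> bool" where
  "is_cycle E c \<longleftrightarrow> length c \<ge> 3 \<and> distinct c \<and> (\<forall>i<length c. cycle_edge c i \<in> E)"

text \<open>Meaningful only when the graph contains a cycle.\<close>

definition girth :: "'v set set \<Rightarrow> nat" where
  "girth E = (LEAST k. \<exists>c. is_cycle E c \<and> length c = k)"

definition cycle_sign :: "('v set \<Rightarrow> real) \<Rightarrow> 'v list \<Rightarrow> real" where
  "cycle_sign \<sigma> c = (\<Prod>i<length c. \<sigma> (cycle_edge c i))"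

definition balanced :: "'v set set \<Rightarrow> ('v set \<Rightarrow> real) \<Rightarrow> bool" where
  "balanced E \<sigma> \<longleftrightarrow> (\<forall>c. is_cycle E c \<longrightarrow> cycle_sign \<sigma> c = 1)"

definition antibalanced :: "'v set set \<Rightarrow> ('v set \<Rightarrow> real) \<Rightarrow> bool" where
  "antibalanced E \<sigma> \<longleftrightarrow>
     (\<forall>c. is_cycle E c \<longrightarrow> cycle_sign \<sigma> c = (if even (length c) then 1 else -1))"

definition complete_graph :: "'v set set \<Rightarrow> bool" where
  "complete_graph E \<longleftrightarrow> E = {{u, v} |u v. u \<noteq> v}"

definition complete_bipartite_graph :: "'v::finite set set \<Rightarrow> nat \<Rightarrow> nat \<Rightarrow> bool" where
  "complete_bipartite_graph E n\<^sub>1 n\<^sub>2 \<longleftrightarrow>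
     (\<exists>X Y. X \<union> Y = UNIV \<and> X \<inter> Y = {} \<and> card X = n\<^sub>1 \<and> card Y = n\<^sub>2 \<and>
            E = {{x, y} |x y. x \<in> X \<and> y \<in> Y})"

definition adj_matrix :: "'v::finite set set \<Rightarrow> ('v set \<Rightarrow> real) \<Rightarrow> real^'v^'v" where
  "adj_matrix E \<sigma> = (\<chi> i j. if {i, j} \<in> E then \<sigma> {i, j} else 0)"

definition is_eigenvalue :: "real^'v^'v \<Rightarrow> real \<Rightarrow> bool" where
  "is_eigenvalue A \<mu> \<longleftrightarrow> (\<exists>x. x \<noteq> 0 \<and> A *v x = \<mu> *\<^sub>R x)"

text \<open>Here \<open>mat \<mu>\<close> is the scalar matrix with diagonal entries \<open>\<mu>\<close>. The rank never exceeds
  \<open>CARD('v)\<close>, so the subtraction of natural numbers does not truncate.\<close>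

definition multiplicity_of :: "real^'v^'v \<Rightarrow> real \<Rightarrow> nat" where
  "multiplicity_of A \<mu> = CARD('v) - rank (mat \<mu> - A)"

end

theory Submission
  imports Defs
begin

text \<open>Write \<open>M = \<mu>I - A\<close> and \<open>g\<close> for the girth. An induced path on \<open>k\<close> vertices gives a triangular
  \<open>(k-1) \<times> (k-1)\<close> submatrix of \<open>M\<close> with nonzero diagonal, so removing one vertex from a shortest cycle
  shows \<open>rank M \<ge> g - 2\<close>. If equality holds, no path on \<open>g\<close> vertices is induced. Attaching a vertex
  outside a shortest cycle to the cycle minus one vertex then closes a 4-cycle, whence \<open>g \<le> 4\<close>.
  For \<open>g = 3\<close> the matrix has rank one and its vanishing \<open>2 \<times> 2\<close> minors force completeness and
  determine the signs. For \<open>g = 4\<close> three independent vertices force \<open>\<mu> = 0\<close>, and every row of \<open>A\<close> is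
  a combination of the rows of the two ends of an edge, which gives the bipartite structure.\<close>

section \<open>Rank bounds from triangular patterns of entries\<close>

lemma rows_eq_range: "rows A = range (($) A)"
  by (auto simp: rows_def row_def vec_lambda_eta)

text \<open>Induction on \<open>k\<close>: the earlier vectors all lie in the hyperplane where
  coordinate \<open>q k\<close> vanishes, and \<open>x k\<close> does not, so \<open>x k\<close> is
  outside their span. This also makes the vectors pairwise distinct, whence the cardinality.\<close>

lemma independent_triangular:
  fixes x :: "nat \<Rightarrow> real^'n"
  assumes "\<And>i. i < k \<Longrightarrow> x i $ q i \<noteq> 0"
    and "\<And>i j. i < j \<Longrightarrow> j < k \<Longrightarrow> x i $ q j = 0"
  shows "independent (x ` {..<k})" and "card (x ` {..<k}) = k"
proof -
  have "independent (x ` {..<k}) \<and> card (x ` {..<k}) = k"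
    using assms
  proof (induction k)
    case 0
    then show ?case by (simp add: independent_empty)
  next
    case (Suc k)
    have "subspace {y :: real^'n. y $ q k = 0}"
      by (auto simp: subspace_def)
    moreover have "x ` {..<k} \<subseteq> {y. y $ q k = 0}"
      using Suc.prems(2) by auto
    ultimately have "span (x ` {..<k}) \<subseteq> {y. y $ q k = 0}"
      by (rule span_minimal[rotated])
    moreover have "x k \<notin> {y. y $ q k = 0}"
      using Suc.prems(1)[OF lessI] by (rule contrapos_nn) (rule CollectD)
    ultimately have notin: "x k \<notin> span (x ` {..<k})"
      by (rule contra_subsetD)
    then have "x k \<notin> x ` {..<k}"
      by (rule contrapos_nn) (rule span_base)
    moreover have "independent (x ` {..<k}) \<and> card (x ` {..<k}) = k"
      using Suc.prems by (intro Suc.IH) auto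
    ultimately show ?case
      using notin by (simp add: lessThan_Suc independent_insert)
  qed
  then show "independent (x ` {..<k})" and "card (x ` {..<k}) = k"
    by auto
qed

lemma rank_ge_triangular:
  fixes A :: "real^'n^'m"
  assumes "\<And>i. i < k \<Longrightarrow> A $ p i $ q i \<noteq> 0"
    and "\<And>i j. i < j \<Longrightarrow> j < k \<Longrightarrow> A $ p i $ q j = 0"
  shows "k \<le> rank A"
proof -
  have T: "independent ((\<lambda>i. A $ p i) ` {..<k})"
    using assms(1,2) by (rule independent_triangular(1))
  have T_card: "card ((\<lambda>i. A $ p i) ` {..<k}) = k"
    using assms(1,2) by (rule independent_triangular(2))
  have "(\<lambda>i. A $ p i) ` {..<k} \<subseteq> rows A"
    by (auto simp: rows_eq_range)
  then have "card ((\<lambda>i. A $ p i) ` {..<k}) \<le> dim (rows A)"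
    using T by (rule independent_card_le_dim)
  then show ?thesis
    unfolding T_card row_rank_def .
qed

lemma rank_le_card_span:
  fixes A :: "real^'n^'m"
  assumes "finite S" and "\<And>i. A $ i \<in> span S"
  shows "rank A \<le> card S"
  unfolding row_rank_def rows_eq_range
  using assms by (intro dim_le_card) auto

text \<open>A triangular pattern whose size reaches the rank provides a basis of the row space, so
  all other rows can be expressed by the chosen ones.\<close>

lemma row_in_span_triangular:
  fixes A :: "real^'n^'m"
  assumes "\<And>i. i < k \<Longrightarrow> A $ p i $ q i \<noteq> 0"
    and "\<And>i j. i < j \<Longrightarrow> j < k \<Longrightarrow> A $ p i $ q j = 0"
    and "rank A \<le> k"
  shows "A $ r \<in> span ((\<lambda>i. A $ p i) ` {..<k})"
proof -
  have T: "independent ((\<lambda>i. A $ p i) ` {..<k})"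
    using assms(1,2) by (rule independent_triangular(1))
  have T_card: "card ((\<lambda>i. A $ p i) ` {..<k}) = k"
    using assms(1,2) by (rule independent_triangular(2))
  have "rows A \<subseteq> span ((\<lambda>i. A $ p i) ` {..<k})"
    using T T_card assms(3) by (intro card_ge_dim_independent) (auto simp: rows_eq_range row_rank_def)
  then show ?thesis
    by (rule subsetD) (simp add: rows_eq_range)
qed

lemma rank_le_one_minor:
  fixes A :: "real^'n^'m"
  assumes "rank A \<le> 1"
  shows "A $ i $ j * A $ k $ l = A $ i $ l * A $ k $ j"
proof (cases "A $ k $ l = 0 \<and> A $ k $ j = 0")
  case True
  then show ?thesis by simp
next
  case False
  \<comment> \<open>A single nonzero entry is a triangular pattern of size one, so row
    \<open>i\<close> is a multiple of row \<open>k\<close>.\<close>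
  then obtain q where "A $ k $ q \<noteq> 0" by auto
  then have "A $ i \<in> span ((\<lambda>_. A $ k) ` {..<1::nat})"
    using assms by (intro row_in_span_triangular[where q = "\<lambda>_. q"]) auto
  then obtain c where "A $ i = c *\<^sub>R A $ k"
    by (auto simp: lessThan_Suc span_singleton)
  then show ?thesis by simp
qed

section \<open>Cycles, girth and connectedness\<close>

lemma is_cycle_iff:
  "is_cycle E c \<longleftrightarrow>
     3 \<le> length c \<and> distinct c \<and> successively (\<lambda>x y. {x, y} \<in> E) c \<and> {last c, hd c} \<in> E"
proof (cases "3 \<le> length c")
  case True
  then have "c \<noteq> []" by auto
  \<comment> \<open>The index \<open>length c - 1\<close> is the one where the successor wraps
    around to 0; its edge closes the path.\<close>
  have "(\<forall>i<length c. cycle_edge c i \<in> E) \<longleftrightarrow>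
      (\<forall>i. Suc i < length c \<longrightarrow> cycle_edge c i \<in> E) \<and> cycle_edge c (length c - 1) \<in> E"
    using \<open>c \<noteq> []\<close>
    by (metis Suc_lessD Suc_lessI Suc_pred' diff_Suc_1 length_greater_0_conv diff_less zero_less_one)
  also have "\<dots> \<longleftrightarrow> successively (\<lambda>x y. {x, y} \<in> E) c \<and> {last c, hd c} \<in> E"
    using \<open>c \<noteq> []\<close> True
    by (auto simp: successively_conv_nth cycle_edge_def last_conv_nth hd_conv_nth)
  finally show ?thesis
    unfolding is_cycle_def by blast
qed (simp add: is_cycle_def)

lemma is_cycle_rotate:
  assumes "is_cycle E c" and "v \<in> set c"
  obtains c' where "is_cycle E (v # c')" and "length (v # c') = length c" and "set (v # c') = set c"
proof -
  obtain xs ys where c: "c = xs @ v # ys"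
    using assms(2) by (meson split_list)
  have "is_cycle E (v # ys @ xs)"
    using assms(1) unfolding c is_cycle_iff
    by (cases xs; cases ys) (auto simp: successively_append_iff successively_Cons hd_append)
  then show thesis
    by (rule that) (auto simp: c)
qed

lemma girth_le: "is_cycle E c \<Longrightarrow> girth E \<le> length c"
  unfolding girth_def by (rule Least_le) auto

lemma girth_cycle:
  assumes "\<exists>c. is_cycle E c"
  obtains c where "is_cycle E c" and "length c = girth E"
proof -
  have "\<exists>c. is_cycle E c \<and> length c = girth E"
    unfolding girth_def by (rule LeastI_ex) (use assms in auto)
  then show thesis using that by blast
qed

lemma girth_ge_3: "\<exists>c. is_cycle E c \<Longrightarrow> 3 \<le> girth E"
  by (metis girth_cycle is_cycle_def)

text \<open>The segment of the path from index \<open>i\<close> to index \<open>j\<close>, closed by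
  the chord, is a cycle; the gap of at least 2 gives it three vertices.\<close>

lemma girth_le_chord:
  assumes "distinct p" and "successively (\<lambda>x y. {x, y} \<in> E) p"
    and "i + 2 \<le> j" and "j < length p" and "{p ! i, p ! j} \<in> E"
  shows "girth E \<le> j - i + 1"
proof -
  let ?q = "take (j - i + 1) (drop i p)"
  have len: "length ?q = j - i + 1"
    using assms by auto
  then have "?q \<noteq> []" by auto
  then have "hd ?q = p ! i" "last ?q = p ! j"
    using assms len by (auto simp: hd_conv_nth last_conv_nth)
  moreover have "successively (\<lambda>x y. {x, y} \<in> E) ?q"
    using assms by (auto simp: successively_conv_nth)
  ultimately have "is_cycle E ?q"
    using assms len by (auto simp: is_cycle_iff insert_commute)
  then show ?thesis
    using girth_le len by metis
qed

text \<open>A walk from \<open>s\<close> to \<open>t\<close> has to leave \<open>S\<close> along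
  some edge.\<close>

lemma connected_graph_boundary:
  assumes "connected_graph E" and "s \<in> S" and "t \<notin> S"
  obtains u v where "u \<in> S" and "v \<notin> S" and "{u, v} \<in> E"
proof -
  have "(s, t) \<in> {(x, y). {x, y} \<in> E}\<^sup>*"
    using assms(1) by (simp add: connected_graph_def)
  then have "\<exists>u v. u \<in> S \<and> v \<notin> S \<and> {u, v} \<in> E"
    using assms(2,3) by (induction rule: rtrancl_induct) auto
  then show thesis using that by blast
qed

text \<open>Every vertex of a cycle lies on two of its edges, so each value of \<open>f\<close>
  enters the product twice and cancels, leaving one factor \<open>s\<close> per edge. Taking
  \<open>s = 1\<close> yields balance and \<open>s = -1\<close> antibalance.\<close>

lemma cycle_sign_switching:
  assumes "is_cycle E c" and "\<And>x. f x * f x = (1::real)"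
    and "\<And>x y. {x, y} \<in> E \<Longrightarrow> \<sigma> {x, y} = s * f x * f y"
  shows "cycle_sign \<sigma> c = s ^ length c"
proof -
  have prod_set: "(\<Prod>i<length d. f (d ! i)) = prod f (set d)" if "distinct d" for d
    using that by (intro prod.reindex_bij_betw bij_betw_nth) auto
  have c: "distinct c" "\<And>i. i < length c \<Longrightarrow> {c ! i, c ! (Suc i mod length c)} \<in> E"
    using assms(1) by (auto simp: is_cycle_def cycle_edge_def)
  have "cycle_sign \<sigma> c = (\<Prod>i<length c. s * f (c ! i) * f (c ! (Suc i mod length c)))"
    unfolding cycle_sign_def cycle_edge_def using assms(3) c(2) by (intro prod.cong) auto
  \<comment> \<open>\<open>rotate1 c\<close> lists the successors, so both vertex factors run over
    \<open>set c\<close> exactly once.\<close>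
  also have "\<dots> = (\<Prod>i<length c. s * f (c ! i) * f (rotate1 c ! i))"
    by (intro prod.cong) (auto simp: nth_rotate1)
  also have "\<dots> = s ^ length c * prod f (set c) * prod f (set c)"
    using prod_set[OF c(1)] prod_set[of "rotate1 c"] c(1) by (simp add: prod.distrib)
  also have "\<dots> = s ^ length c"
    using assms(2) by (simp add: mult.assoc flip: prod.distrib)
  finally show ?thesis .
qed

section \<open>The characteristic matrix and the lower bound on its rank\<close>

context signed_graph
begin

lemma edge_neq: "{x, y} \<in> E \<Longrightarrow> x \<noteq> y"
  using edge_card[of "{x, y}"] by auto

lemma sign_square: "e \<in> E \<Longrightarrow> \<sigma> e * \<sigma> e = 1"
  using edge_sign by fastforce

lemma sign_neq_0: "e \<in> E \<Longrightarrow> \<sigma> e \<noteq> 0"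
  using edge_sign by fastforce

definition char_matrix :: "real \<Rightarrow> real^'v^'v" where
  "char_matrix \<mu> = mat \<mu> - adj_matrix E \<sigma>"

lemma char_matrix_diag: "char_matrix \<mu> $ i $ i = \<mu>"
  using edge_neq[of i i] by (auto simp: char_matrix_def mat_def adj_matrix_def)

lemma char_matrix_edge: "{i, j} \<in> E \<Longrightarrow> char_matrix \<mu> $ i $ j = - \<sigma> {i, j}"
  using edge_neq[of i j] by (auto simp: char_matrix_def mat_def adj_matrix_def)

lemma char_matrix_nonedge:
  "i \<noteq> j \<Longrightarrow> {i, j} \<notin> E \<Longrightarrow> char_matrix \<mu> $ i $ j = 0"
  by (auto simp: char_matrix_def mat_def adj_matrix_def)

text \<open>Take all path vertices but the last as rows and all but the first as columns. The pivots
  are path edges; the entries that must vanish join vertices at least two steps apart. None of these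
  positions is on the diagonal of the full matrix, so the bound is the same for every
  \<open>\<mu>\<close>.\<close>

lemma rank_ge_induced_path:
  assumes "distinct p" and "successively (\<lambda>x y. {x, y} \<in> E) p"
    and "\<And>i j. i + 2 \<le> j \<Longrightarrow> j < length p \<Longrightarrow> {p ! i, p ! j} \<notin> E"
  shows "length p - 1 \<le> rank (char_matrix \<mu>)"
proof (rule rank_ge_triangular)
  fix i assume "i < length p - 1"
  then have "{p ! i, p ! Suc i} \<in> E"
    using assms(2) by (auto simp: successively_conv_nth)
  then show "char_matrix \<mu> $ (p ! i) $ (p ! Suc i) \<noteq> 0"
    using sign_neq_0 by (simp add: char_matrix_edge)
next
  fix i j assume "i < j" "j < length p - 1"
  then show "char_matrix \<mu> $ (p ! i) $ (p ! Suc j) = 0"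
    using assms(1,3) by (intro char_matrix_nonedge) (auto simp: nth_eq_iff_index_eq)
qed

text \<open>A shortest cycle without its last vertex is an induced path: a chord would close a cycle
  on at most \<open>girth E - 1\<close> vertices.\<close>

lemma rank_ge_girth:
  assumes "\<exists>c. is_cycle E c"
  shows "girth E - 2 \<le> rank (char_matrix \<mu>)"
proof -
  obtain c where c: "is_cycle E c" "length c = girth E"
    using assms girth_cycle by blast
  have p: "distinct (butlast c)" "successively (\<lambda>x y. {x, y} \<in> E) (butlast c)"
    using c(1) by (auto simp: is_cycle_iff distinct_butlast successively_conv_nth nth_butlast)
  have "{butlast c ! i, butlast c ! j} \<notin> E" if "i + 2 \<le> j" "j < length (butlast c)" for i j
    using girth_le_chord[OF p that] that c(2) by auto
  then show ?thesis
    using rank_ge_induced_path[OF p, of \<mu>] c(2) by simp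
qed

section \<open>Local structure when the rank is minimal\<close>

lemma path_ends_adjacent:
  assumes "rank (char_matrix \<mu>) = girth E - 2" and "2 \<le> girth E"
    and "length p = girth E"
    and "distinct p" and "successively (\<lambda>x y. {x, y} \<in> E) p"
  shows "{hd p, last p} \<in> E"
proof (rule ccontr)
  assume "{hd p, last p} \<notin> E"
  moreover have "p \<noteq> []"
    using assms by auto
  ultimately have ends: "{p ! 0, p ! (length p - 1)} \<notin> E"
    by (simp add: hd_conv_nth last_conv_nth)
  \<comment> \<open>A chord that does not join the two ends would give a cycle shorter than the
    girth. The path is therefore induced, and its rank bound \<open>girth E - 1\<close> exceeds the
    assumed rank.\<close>
  have "{p ! i, p ! j} \<notin> E" if "i + 2 \<le> j" "j < length p" for i j
  proof
    assume "{p ! i, p ! j} \<in> E"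
    with girth_le_chord[OF assms(4,5) that] have "girth E \<le> j - i + 1"
      by blast
    then have "i = 0" "j = length p - 1"
      using that assms(3) by auto
    then show False
      using ends \<open>{p ! i, p ! j} \<in> E\<close> by simp
  qed
  then show False
    using rank_ge_induced_path[OF assms(4,5), of \<mu>] assms(1-3) by fastforce
qed

text \<open>The vertex \<open>v\<close> lies outside a shortest cycle and is attached to it at
  \<open>a\<close>. For girth 4 that shortest cycle itself is also returned, so that
  \<open>a\<close> has the three neighbours \<open>v\<close>, \<open>x\<close> and
  \<open>z\<close>.\<close>

lemma extremal_four_cycle:
  assumes "connected_graph E" and "\<exists>c. is_cycle E c" and "girth E < CARD('v)"
    and "rank (char_matrix \<mu>) = girth E - 2"
  obtains v a x y z where "is_cycle E [v, y, z, a]" and "girth E = 4 \<Longrightarrow> is_cycle E [a, x, y, z]"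
    and "girth E = 4 \<Longrightarrow> v \<noteq> x"
proof -
  obtain c where c: "is_cycle E c" "length c = girth E"
    using assms girth_cycle by blast
  then have "card (set c) < CARD('v)"
    using assms(3) card_length[of c] by linarith
  then obtain t where "t \<notin> set c"
    by (metis UNIV_eq_I less_irrefl)
  moreover have "hd c \<in> set c"
    using c(1) by (cases c) (auto simp: is_cycle_def)
  ultimately obtain a v where av: "a \<in> set c" "v \<notin> set c" "{a, v} \<in> E"
    using connected_graph_boundary[OF assms(1), of "hd c" "set c" t] by metis
  obtain c' where c': "is_cycle E (a # c')" "length (a # c') = girth E" "set (a # c') = set c"
    using is_cycle_rotate[OF c(1) av(1)] c(2) by metis
  obtain d z where d: "c' = d @ [z]"
    using c'(1) by (cases c' rule: rev_cases) (auto simp: is_cycle_def)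
  obtain xs y where xs: "d = xs @ [y]"
    using c'(1) d by (cases d rule: rev_cases) (auto simp: is_cycle_def)
  have cyc: "is_cycle E (a # xs @ [y, z])" and v: "v \<notin> set (a # xs @ [y, z])"
    and len: "girth E = length xs + 3"
    using c' av(2) by (auto simp: d xs)
  \<comment> \<open>Replacing \<open>z\<close> by \<open>v\<close> in front of \<open>a\<close>
    keeps the number of vertices equal to the girth, so the ends \<open>v\<close> and
    \<open>y\<close> are adjacent.\<close>
  have "{hd (v # a # xs @ [y]), last (v # a # xs @ [y])} \<in> E"
    using cyc v len av(3)
    by (intro path_ends_adjacent[OF assms(4)])
      (auto simp: is_cycle_iff successively_append_iff successively_Cons hd_append insert_commute)
  then have "is_cycle E [v, y, z, a]"
    using cyc v av(3) by (auto simp: is_cycle_iff successively_append_iff successively_Cons insert_commute)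
  moreover have "is_cycle E [a, hd xs, y, z] \<and> v \<noteq> hd xs" if "girth E = 4"
  proof -
    from that len obtain x where "xs = [x]"
      by (auto simp: length_Suc_conv)
    then show ?thesis using cyc v by auto
  qed
  ultimately show thesis
    using that by blast
qed

lemma no_triangle:
  assumes "4 \<le> girth E" and "{x, y} \<in> E" and "{y, z} \<in> E"
  shows "{x, z} \<notin> E"
proof
  assume "{x, z} \<in> E"
  with assms edge_neq have "is_cycle E [x, y, z]"
    by (auto simp: is_cycle_iff insert_commute)
  with girth_le assms(1) show False by fastforce
qed

text \<open>Without triangles the three neighbours \<open>v\<close>, \<open>x\<close>,
  \<open>z\<close> of \<open>a\<close> are pairwise nonadjacent, so their principal submatrix is
  \<open>\<mu>\<close> times the identity. For nonzero \<open>\<mu>\<close> it would have rank 3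
  instead of at most 2.\<close>

lemma extremal_eigenvalue_zero:
  assumes "connected_graph E" and "\<exists>c. is_cycle E c" and "girth E < CARD('v)"
    and "rank (char_matrix \<mu>) = girth E - 2" and "girth E = 4"
  shows "\<mu> = 0"
proof (rule ccontr)
  assume "\<mu> \<noteq> 0"
  obtain v a x y z where C: "is_cycle E [v, y, z, a]" "is_cycle E [a, x, y, z]" "v \<noteq> x"
    using extremal_four_cycle[OF assms(1-4)] assms(5) by metis
  have nb: "{v, a} \<in> E" "{x, a} \<in> E" "{z, a} \<in> E" and neq: "v \<noteq> z" "x \<noteq> z"
    using C(1,2) by (auto simp: is_cycle_iff insert_commute)
  have indep: "{v, x} \<notin> E" "{v, z} \<notin> E" "{x, z} \<notin> E"
    using no_triangle[of _ a] nb assms(5) by (auto simp: insert_commute)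
  have "3 \<le> rank (char_matrix \<mu>)"
  proof (rule rank_ge_triangular)
    fix i :: nat assume "i < 3"
    show "char_matrix \<mu> $ ([v, x, z] ! i) $ ([v, x, z] ! i) \<noteq> 0"
      using \<open>\<mu> \<noteq> 0\<close> by (simp only: char_matrix_diag not_False_eq_True)
  next
    fix i j :: nat assume "i < j" "j < 3"
    then consider "i = 0" "j = 1" | "i = 0" "j = 2" | "i = 1" "j = 2"
      by linarith
    then show "char_matrix \<mu> $ ([v, x, z] ! i) $ ([v, x, z] ! j) = 0"
      using indep neq C(3) by cases (simp_all add: char_matrix_nonedge)
  qed
  then show False
    using assms(4,5) by simp
qed

section \<open>Rank one and complete graphs\<close>

lemma complete_graph_iff: "complete_graph E \<longleftrightarrow> (\<forall>x y. x \<noteq> y \<longrightarrow> {x, y} \<in> E)"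
proof
  assume "\<forall>x y. x \<noteq> y \<longrightarrow> {x, y} \<in> E"
  then show "complete_graph E"
    unfolding complete_graph_def using edge_card by (auto simp: card_2_iff)
qed (auto simp: complete_graph_def)

lemma cycle_sign_triangle: "cycle_sign \<sigma> [x, y, z] = \<sigma> {x, y} * \<sigma> {y, z} * \<sigma> {z, x}"
  by (simp add: cycle_sign_def cycle_edge_def prod.lessThan_Suc mult_ac)

lemma cycle_sign_quadrangle:
  "cycle_sign \<sigma> [w, x, y, z] = \<sigma> {w, x} * \<sigma> {x, y} * \<sigma> {y, z} * \<sigma> {z, w}"
  by (simp add: cycle_sign_def cycle_edge_def prod.lessThan_Suc mult_ac)

lemma rank_le_one_imp_complete:
  assumes "rank (char_matrix \<mu>) \<le> 1" and "{u, v} \<in> E"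
  obtains f where "complete_graph E" and "\<mu> * \<mu> = 1" and "\<And>x. f x * f x = 1"
    and "\<And>x y. {x, y} \<in> E \<Longrightarrow> \<sigma> {x, y} = - \<mu> * f x * f y"
proof -
  note minor = rank_le_one_minor[OF assms(1)]
  \<comment> \<open>The principal minor on an edge compares \<open>\<mu> * \<mu>\<close> with a
    squared sign; on a nonadjacent pair it would give \<open>\<mu> * \<mu> = 0\<close>, which is why
    all pairs are adjacent.\<close>
  have mu: "\<mu> * \<mu> = 1"
    using minor[of u u v v] assms(2) sign_square[OF assms(2)]
    by (simp add: char_matrix_diag char_matrix_edge insert_commute)
  have adj: "{x, y} \<in> E" if "x \<noteq> y" for x y
  proof (rule ccontr)
    assume "{x, y} \<notin> E"
    then show False
      using minor[of x x y y] mu that by (simp add: char_matrix_diag char_matrix_nonedge insert_commute)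
  qed
  \<comment> \<open>Column \<open>u\<close> serves as switching function: the minor on rows
    \<open>x\<close>, \<open>u\<close> and columns \<open>y\<close>, \<open>u\<close> expresses
    entry \<open>x\<close>, \<open>y\<close> through it.\<close>
  let ?f = "\<lambda>x. char_matrix \<mu> $ x $ u"
  have sym: "char_matrix \<mu> $ x $ y = char_matrix \<mu> $ y $ x" for x y
    using adj[of x y] by (cases "x = y") (auto simp: char_matrix_edge insert_commute)
  have "?f x * ?f x = 1" for x
    using minor[of x x u u] mu sym[of x u] by (simp add: char_matrix_diag)
  moreover have "\<sigma> {x, y} = - \<mu> * ?f x * ?f y" if "{x, y} \<in> E" for x y
  proof -
    have "- \<sigma> {x, y} * \<mu> = ?f x * ?f y"
      using minor[of x y u u] that sym[of y u] by (simp add: char_matrix_diag char_matrix_edge)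
    then show ?thesis using mu by algebra
  qed
  ultimately show thesis
    using adj mu by (intro that[of ?f]) (simp_all add: complete_graph_iff)
qed

text \<open>All rows are multiples of one row \<open>k\<close>. The triangle hypothesis covers both
  the balanced case with \<open>\<mu> = -1\<close> and the antibalanced case with
  \<open>\<mu> = 1\<close>.\<close>

lemma complete_imp_rank_le_one:
  assumes "complete_graph E" and "\<mu> * \<mu> = 1"
    and "\<And>x y z. is_cycle E [x, y, z] \<Longrightarrow> cycle_sign \<sigma> [x, y, z] = - \<mu>"
  shows "rank (char_matrix \<mu>) \<le> 1"
proof -
  fix k :: 'v
  have adj: "{x, y} \<in> E" if "x \<noteq> y" for x y
    using assms(1) that by (simp add: complete_graph_iff)
  \<comment> \<open>This is the vanishing minor with pivot entry \<open>\<mu>\<close> at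
    \<open>k\<close>, where \<open>\<mu>\<close> is its own inverse. Only distinct \<open>i\<close>,
    \<open>j\<close>, \<open>k\<close> require the sign of a triangle.\<close>
  have minor: "char_matrix \<mu> $ i $ j = \<mu> * char_matrix \<mu> $ i $ k * char_matrix \<mu> $ k $ j" for i j
  proof -
    consider "i = k" | "j = k" | "i = j" "i \<noteq> k" | "i \<noteq> j" "i \<noteq> k" "j \<noteq> k"
      by blast
    then show ?thesis
    proof cases
      case 3
      then show ?thesis
        using adj[of i k] sign_square[of "{i, k}"]
        by (simp add: char_matrix_diag char_matrix_edge insert_commute mult.assoc)
    next
      case 4
      let ?s = "\<sigma> {j, k} * \<sigma> {k, i}"
      have "is_cycle E [i, j, k]"
        using 4 adj by (simp add: is_cycle_iff)
      then have "\<sigma> {i, j} * ?s = - \<mu>"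
        using assms(3) by (simp add: cycle_sign_triangle mult.assoc)
      moreover have "\<sigma> {j, k} * \<sigma> {j, k} = 1" "\<sigma> {k, i} * \<sigma> {k, i} = 1"
        using 4 by (auto intro: sign_square adj)
      ultimately have "- \<sigma> {i, j} = \<mu> * ?s"
        by algebra
      then show ?thesis
        using 4 adj by (simp add: char_matrix_edge insert_commute mult_ac)
    qed (use assms(2) in \<open>simp_all add: char_matrix_diag\<close>)
  qed
  have row: "char_matrix \<mu> $ i = (\<mu> * char_matrix \<mu> $ i $ k) *\<^sub>R char_matrix \<mu> $ k" for i
    by (subst vec_eq_iff, rule allI, subst minor) simp
  have "char_matrix \<mu> $ i \<in> span {char_matrix \<mu> $ k}" for i
    by (subst row[of i]) (intro span_scale span_base singletonI)
  then show ?thesis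
    using rank_le_card_span[of "{char_matrix \<mu> $ k}" "char_matrix \<mu>"] by simp
qed

lemma complete_girth:
  assumes "complete_graph E" and "\<exists>c. is_cycle E c"
  shows "girth E = 3"
proof -
  obtain c where "is_cycle E c" using assms(2) by blast
  then have "3 \<le> length c" "distinct c"
    by (auto simp: is_cycle_def)
  then obtain x y z d where "c = x # y # z # d"
    by (auto simp: Suc_le_length_iff numeral_3_eq_3)
  with \<open>distinct c\<close> have "distinct [x, y, z]"
    by simp
  then have "is_cycle E [x, y, z]"
    using assms(1) unfolding complete_graph_iff is_cycle_iff by auto
  then have "girth E \<le> 3"
    using girth_le[of E "[x, y, z]"] by simp
  with girth_ge_3[OF assms(2)] show ?thesis by simp
qed

section \<open>Rank two and complete bipartite graphs\<close>

lemma char_matrix_zero_eq_0_iff: "char_matrix 0 $ x $ y = 0 \<longleftrightarrow> {x, y} \<notin> E"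
  using char_matrix_diag[of 0 x] edge_neq[of x y] sign_neq_0[of "{x, y}"]
  by (cases "x = y") (auto simp: char_matrix_edge char_matrix_nonedge)

text \<open>For eigenvalue 0, rows \<open>u\<close>, \<open>v\<close> restricted to columns
  \<open>v\<close>, \<open>u\<close> form a diagonal block with entries
  \<open>- \<sigma> {u, v}\<close>. Hence these rows span the row space, and the coefficients of row
  \<open>w\<close> are read off in columns \<open>u\<close> and \<open>v\<close>.\<close>

lemma rank_le_two_rows:
  assumes "rank (char_matrix 0) \<le> 2" and "{u, v} \<in> E"
  shows "char_matrix 0 $ w $ x = - \<sigma> {u, v} *
    (char_matrix 0 $ w $ v * char_matrix 0 $ u $ x + char_matrix 0 $ w $ u * char_matrix 0 $ v $ x)"
proof -
  let ?M = "char_matrix 0"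
  have "?M $ w \<in> span ((\<lambda>i. ?M $ ([u, v] ! i)) ` {..<2})"
  proof (rule row_in_span_triangular[where q = "\<lambda>i. [v, u] ! i"])
    fix i :: nat assume "i < 2"
    then show "?M $ ([u, v] ! i) $ ([v, u] ! i) \<noteq> 0"
      using assms(2) by (auto simp: less_2_cases_iff char_matrix_zero_eq_0_iff insert_commute)
  next
    fix i j :: nat assume "i < j" "j < 2"
    then show "?M $ ([u, v] ! i) $ ([v, u] ! j) = 0"
      by (auto simp: less_2_cases_iff char_matrix_diag)
  qed (rule assms(1))
  moreover have "(\<lambda>i. ?M $ ([u, v] ! i)) ` {..<2} = {?M $ u, ?M $ v}"
    by (auto simp: numeral_2_eq_2 lessThan_Suc)
  ultimately have "?M $ w \<in> span {?M $ u, ?M $ v}"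
    by (simp only:)
  then obtain a where "?M $ w - a *\<^sub>R ?M $ u \<in> span {?M $ v}"
    using span_breakdown_eq[of _ "?M $ u" "{?M $ v}"] by blast
  then obtain b where "?M $ w - a *\<^sub>R ?M $ u = b *\<^sub>R ?M $ v"
    unfolding span_singleton by (elim rangeE)
  then have "?M $ w = a *\<^sub>R ?M $ u + b *\<^sub>R ?M $ v"
    by (simp add: algebra_simps)
  then have row: "?M $ w $ y = a * ?M $ u $ y + b * ?M $ v $ y" for y
    by simp
  have "a = - \<sigma> {u, v} * ?M $ w $ v" "b = - \<sigma> {u, v} * ?M $ w $ u"
    using row[of u] row[of v] assms(2) sign_square[OF assms(2)]
    by (simp_all add: char_matrix_diag char_matrix_edge insert_commute)
  then show ?thesis
    using row[of x] by (simp add: algebra_simps)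
qed

text \<open>The parts are the neighbourhoods of \<open>v\<close> and \<open>u\<close>. A vertex of
  \<open>X\<close> has a row proportional to row \<open>u\<close>, hence the same neighbours as
  \<open>u\<close>; likewise for \<open>Y\<close> and \<open>v\<close>. The proportionality factors
  also determine the signs.\<close>

lemma rank_le_two_imp_bipartite:
  assumes "connected_graph E" and "4 \<le> girth E" and "{u, v} \<in> E" and "rank (char_matrix 0) \<le> 2"
  obtains X Y where "X \<union> Y = UNIV" and "X \<inter> Y = {}"
    and "E = {{x, y} |x y. x \<in> X \<and> y \<in> Y}" and "balanced E \<sigma>"
proof -
  let ?M = "char_matrix 0"
  define X Y where "X = {w. {w, v} \<in> E}" and "Y = {w. {w, u} \<in> E}"
  note rows = rank_le_two_rows[OF assms(4,3)]
  have disj: "X \<inter> Y = {}"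
    using no_triangle[OF assms(2), of u _ v] assms(3) by (auto simp: X_def Y_def insert_commute)
  have "w \<in> X \<or> w \<in> Y" for w
  proof -
    have "u \<noteq> w \<or> v \<noteq> w"
      using edge_neq[OF assms(3)] by auto
    then obtain t where "t \<noteq> w" by blast
    \<comment> \<open>Connectedness gives \<open>w\<close> a neighbour, so row \<open>w\<close> is
      nonzero and has a nonzero coefficient at row \<open>u\<close> or row \<open>v\<close>.\<close>
    then obtain x where "{w, x} \<in> E"
      using connected_graph_boundary[OF assms(1), of w "{w}" t] by auto
    then have "?M $ w $ x \<noteq> 0"
      by (simp add: char_matrix_zero_eq_0_iff)
    then have "?M $ w $ v \<noteq> 0 \<or> ?M $ w $ u \<noteq> 0"
      using rows[of w x] by auto
    then show ?thesis
      by (auto simp: X_def Y_def char_matrix_zero_eq_0_iff)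
  qed
  then have cover: "X \<union> Y = UNIV" by blast
  \<comment> \<open>By disjointness \<open>w\<close> is not adjacent to \<open>u\<close>, so the
    term with row \<open>v\<close> drops out.\<close>
  have rowX: "?M $ w $ x = - \<sigma> {u, v} * (?M $ w $ v * ?M $ u $ x)" if "w \<in> X" for w x
    using rows[of w x] that disj char_matrix_zero_eq_0_iff[of w u] by (auto simp: Y_def)
  have rowY: "?M $ w $ x = - \<sigma> {u, v} * (?M $ w $ u * ?M $ v $ x)" if "w \<in> Y" for w x
    using rows[of w x] that disj char_matrix_zero_eq_0_iff[of w v] by (auto simp: X_def)
  have adjX: "{w, x} \<in> E \<longleftrightarrow> x \<in> Y" if "w \<in> X" for w x
  proof -
    have "?M $ w $ x \<noteq> 0 \<longleftrightarrow> ?M $ u $ x \<noteq> 0"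
      using that sign_neq_0[OF assms(3)] char_matrix_zero_eq_0_iff[of w v]
      unfolding rowX[OF that, of x] by (auto simp: X_def)
    then show ?thesis
      by (simp add: char_matrix_zero_eq_0_iff Y_def insert_commute)
  qed
  have adjY: "{w, x} \<in> E \<longleftrightarrow> x \<in> X" if "w \<in> Y" for w x
  proof -
    have "?M $ w $ x \<noteq> 0 \<longleftrightarrow> ?M $ v $ x \<noteq> 0"
      using that sign_neq_0[OF assms(3)] char_matrix_zero_eq_0_iff[of w u]
      unfolding rowY[OF that, of x] by (auto simp: Y_def)
    then show ?thesis
      by (simp add: char_matrix_zero_eq_0_iff X_def insert_commute)
  qed
  have "E \<subseteq> {{x, y} |x y. x \<in> X \<and> y \<in> Y}"
  proof
    fix e assume "e \<in> E"
    then obtain a b where "e = {a, b}"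
      using edge_card[OF \<open>e \<in> E\<close>] by (auto simp: card_2_iff)
    moreover have "a \<in> X \<and> b \<in> Y \<or> b \<in> X \<and> a \<in> Y"
      using \<open>e \<in> E\<close> cover adjX[of a b] adjY[of a b] unfolding \<open>e = {a, b}\<close> by blast
    ultimately show "e \<in> {{x, y} |x y. x \<in> X \<and> y \<in> Y}"
      using insert_commute[of a b "{}"] by blast
  qed
  moreover have "{{x, y} |x y. x \<in> X \<and> y \<in> Y} \<subseteq> E"
    by (auto simp: adjX)
  ultimately have E: "E = {{x, y} |x y. x \<in> X \<and> y \<in> Y}"
    by (rule subset_antisym)
  \<comment> \<open>\<open>rowX\<close> factors the sign of an edge \<open>x\<close>,
    \<open>y\<close> as \<open>\<sigma> {x, v} * \<sigma> {u, v} * \<sigma> {y, u}\<close>; the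
    middle factor is assigned to the endpoint in \<open>Y\<close>.\<close>
  define f where "f w = (if w \<in> X then \<sigma> {w, v} else \<sigma> {u, v} * \<sigma> {w, u})" for w
  have f_sq: "f w * f w = 1" for w
  proof (cases "w \<in> X")
    case True
    then show ?thesis by (simp add: f_def X_def sign_square)
  next
    case False
    then have "w \<in> Y" using cover by blast
    then have "{w, u} \<in> E" by (simp add: Y_def)
    then have "\<sigma> {w, u} * \<sigma> {w, u} = 1" by (rule sign_square)
    moreover have "f w = \<sigma> {u, v} * \<sigma> {w, u}"
      using False by (simp add: f_def)
    ultimately show ?thesis
      using sign_square[OF assms(3)] by algebra
  qed
  have f_XY: "\<sigma> {x, y} = f x * f y" if "x \<in> X" "y \<in> Y" for x y
  proof -
    have "{x, y} \<in> E" "{x, v} \<in> E" "{y, u} \<in> E"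
      using that adjX[of x y] by (simp_all add: X_def Y_def)
    then have "\<sigma> {x, y} = \<sigma> {u, v} * (\<sigma> {x, v} * \<sigma> {y, u})"
      using rowX[OF that(1), of y] by (simp add: char_matrix_edge insert_commute)
    moreover have "y \<notin> X"
      using that disj by blast
    ultimately show ?thesis
      using that by (simp add: f_def)
  qed
  have f_sign: "\<sigma> {x, y} = 1 * f x * f y" if "{x, y} \<in> E" for x y
  proof (cases "x \<in> X")
    case True
    then show ?thesis
      using that adjX[of x y] f_XY[of x y] by simp
  next
    case False
    then have "x \<in> Y" "y \<in> X"
      using cover that adjY[of x y] by blast+
    then show ?thesis
      using f_XY[of y x] by (simp add: insert_commute mult.commute)
  qed
  have "cycle_sign \<sigma> c = 1" if "is_cycle E c" for c
    using cycle_sign_switching[where f = f, OF that f_sq f_sign] by simp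
  then have "balanced E \<sigma>"
    by (simp add: balanced_def)
  with cover disj E show thesis
    by (rule that)
qed

lemma bipartite_adjacent_iff:
  assumes "X \<inter> Y = {}" and "E = {{x, y} |x y. x \<in> X \<and> y \<in> Y}"
  shows "{a, b} \<in> E \<longleftrightarrow> a \<in> X \<and> b \<in> Y \<or> a \<in> Y \<and> b \<in> X"
  using assms by (auto simp: doubleton_eq_iff)

text \<open>Balance of the quadrangles through the fixed edge \<open>u\<close>, \<open>v\<close>
  recovers the identity of \<open>rank_le_two_rows\<close>, so rows \<open>u\<close> and
  \<open>v\<close> span all rows.\<close>

lemma complete_bipartite_imp_rank_le_two:
  assumes "X \<union> Y = UNIV" and "X \<inter> Y = {}" and E: "E = {{x, y} |x y. x \<in> X \<and> y \<in> Y}"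
    and "u \<in> X" and "v \<in> Y" and "balanced E \<sigma>"
  shows "rank (char_matrix 0) \<le> 2"
proof -
  let ?M = "char_matrix 0"
  note adj = bipartite_adjacent_iff[OF assms(2) E]
  have M0: "?M $ x $ y = 0" if "x \<in> X \<and> y \<in> X \<or> x \<in> Y \<and> y \<in> Y" for x y
    using that assms(2) by (auto simp: char_matrix_zero_eq_0_iff adj)
  have sgn: "\<sigma> {w, x} = \<sigma> {w, v} * \<sigma> {u, v} * \<sigma> {u, x}" if "w \<in> X" "x \<in> Y" for w x
  proof -
    have "\<sigma> {w, x} * \<sigma> {x, u} * \<sigma> {u, v} * \<sigma> {v, w} = 1"
    proof (cases "w = u \<or> x = v")
      case True
      \<comment> \<open>Here the closed walk is not a cycle; its edges cancel in pairs.\<close>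
      then show ?thesis
        using sign_square[of "{u, v}"] sign_square[of "{w, x}"] that assms(4,5)
        by (auto simp: adj insert_commute mult_ac)
    next
      case False
      then have "is_cycle E [w, x, u, v]"
        using that assms(2,4,5) by (auto simp: is_cycle_iff adj)
      then show ?thesis
        using assms(6) unfolding balanced_def by (metis cycle_sign_quadrangle)
    qed
    moreover have "\<sigma> {x, u} * \<sigma> {x, u} = 1" "\<sigma> {u, v} * \<sigma> {u, v} = 1" "\<sigma> {v, w} * \<sigma> {v, w} = 1"
      using that assms(4,5) by (auto intro!: sign_square simp: adj)
    ultimately have "\<sigma> {w, x} = \<sigma> {v, w} * \<sigma> {u, v} * \<sigma> {x, u}"
      by algebra
    then show ?thesis
      by (simp add: insert_commute)
  qed
  have entry: "?M $ w $ x = - \<sigma> {u, v} * (?M $ w $ v * ?M $ u $ x + ?M $ w $ u * ?M $ v $ x)" for w x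
  proof -
    consider "w \<in> X \<and> x \<in> X \<or> w \<in> Y \<and> x \<in> Y" | "w \<in> X" "x \<in> Y" | "w \<in> Y" "x \<in> X"
      using assms(1) by blast
    then show ?thesis
    proof cases
      case 1
      then show ?thesis using M0 assms(4,5) by auto
    next
      case 2
      then show ?thesis
        using M0[of w u] sgn[of w x] assms(4,5)
        by (simp add: char_matrix_edge adj mult_ac)
    next
      case 3
      then show ?thesis
        using M0[of w v] sgn[of x w] assms(4,5)
        by (simp add: char_matrix_edge adj insert_commute mult_ac)
    qed
  qed
  have "?M $ w = (- \<sigma> {u, v} * ?M $ w $ v) *\<^sub>R ?M $ u + (- \<sigma> {u, v} * ?M $ w $ u) *\<^sub>R ?M $ v" for w
    by (subst vec_eq_iff, rule allI, subst entry) (simp add: algebra_simps)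
  moreover have "a *\<^sub>R ?M $ u + b *\<^sub>R ?M $ v \<in> span {?M $ u, ?M $ v}" for a b
    by (intro span_add span_scale span_base) auto
  ultimately have "?M $ w \<in> span {?M $ u, ?M $ v}" for w
    by metis
  then have "rank ?M \<le> card {?M $ u, ?M $ v}"
    by (intro rank_le_card_span) auto
  also have "\<dots> \<le> 2"
    by (simp add: card_insert_if)
  finally show ?thesis .
qed

text \<open>Two vertices from each part form a quadrangle, and a triangle cannot alternate between
  the parts.\<close>

lemma complete_bipartite_girth:
  assumes "X \<inter> Y = {}" and E: "E = {{x, y} |x y. x \<in> X \<and> y \<in> Y}"
    and "2 \<le> card X" and "2 \<le> card Y"
  shows "girth E = 4"
proof -
  note adj = bipartite_adjacent_iff[OF assms(1) E]
  have two_distinct: thesis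
    if S: "2 \<le> card S" and elts: "\<And>s t. s \<in> S \<Longrightarrow> t \<in> S \<Longrightarrow> s \<noteq> t \<Longrightarrow> thesis" for S :: "'v set" and thesis
  proof -
    obtain T where "T \<subseteq> S" "card T = 2"
      using obtain_subset_with_card_n[OF S] by blast
    then show thesis
      using elts by (auto simp: card_2_iff)
  qed
  obtain a b where "a \<in> X" "b \<in> X" "a \<noteq> b"
    by (rule two_distinct[OF assms(3)])
  moreover obtain c d where "c \<in> Y" "d \<in> Y" "c \<noteq> d"
    by (rule two_distinct[OF assms(4)])
  ultimately have cyc: "is_cycle E [a, c, b, d]"
    using assms(1) by (auto simp: is_cycle_iff adj)
  have "girth E \<noteq> 3"
  proof
    assume "girth E = 3"
    then obtain p where "is_cycle E p" "length p = 3"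
      using cyc girth_cycle by metis
    then obtain x y z where "is_cycle E [x, y, z]"
      by (auto simp: length_Suc_conv numeral_3_eq_3)
    then show False
      using assms(1) by (auto simp: is_cycle_iff adj)
  qed
  moreover have "3 \<le> girth E"
    using cyc by (intro girth_ge_3) blast
  moreover have "girth E \<le> 4"
    using girth_le[OF cyc] by simp
  ultimately show ?thesis by linarith
qed

lemma bipartite_parts_ge_two:
  assumes "X \<inter> Y = {}" and E: "E = {{x, y} |x y. x \<in> X \<and> y \<in> Y}" and "is_cycle E [a, b, c, d]"
  shows "2 \<le> card X" and "2 \<le> card Y"
proof -
  have two: "2 \<le> card S" if "s \<in> S" "t \<in> S" "s \<noteq> t" for s t and S :: "'v set"
    using card_mono[of S "{s, t}"] that by simp
  have neq: "a \<noteq> c" "b \<noteq> d" and "{a, b} \<in> E" "{b, c} \<in> E" "{c, d} \<in> E"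
    using assms(3) by (simp_all add: is_cycle_iff)
  then have "a \<in> X \<and> c \<in> X \<and> b \<in> Y \<and> d \<in> Y \<or> a \<in> Y \<and> c \<in> Y \<and> b \<in> X \<and> d \<in> X"
    using assms(1) unfolding bipartite_adjacent_iff[OF assms(1) E] by blast
  then show "2 \<le> card X" and "2 \<le> card Y"
    using two[of a X c] two[of b X d] two[of a Y c] two[of b Y d] neq by blast+
qed

section \<open>Characterisation of equality and transfer to the multiplicity\<close>

lemma rank_eq_imp_extremal:
  assumes "connected_graph E" and "\<exists>c. is_cycle E c" and "girth E < CARD('v)"
    and rank: "rank (char_matrix \<mu>) = girth E - 2"
  shows "(complete_graph E \<and> balanced E \<sigma> \<and> \<mu> = -1) \<or>
    (complete_graph E \<and> antibalanced E \<sigma> \<and> \<mu> = 1) \<or>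
    (\<exists>n\<^sub>1 n\<^sub>2. n\<^sub>1 \<ge> 2 \<and> n\<^sub>2 \<ge> 2 \<and> complete_bipartite_graph E n\<^sub>1 n\<^sub>2 \<and> balanced E \<sigma> \<and> \<mu> = 0)"
proof -
  obtain v a x y z where C: "is_cycle E [v, y, z, a]" "girth E = 4 \<Longrightarrow> is_cycle E [a, x, y, z]"
    using extremal_four_cycle[OF assms] by metis
  have edge: "{v, y} \<in> E"
    using C(1) by (simp add: is_cycle_iff)
  have "girth E \<le> 4"
    using girth_le[OF C(1)] by simp
  with girth_ge_3[OF assms(2)] consider "girth E = 3" | "girth E = 4"
    by linarith
  then show ?thesis
  proof cases
    case 1
    then obtain f where f: "complete_graph E" "\<mu> * \<mu> = 1" "\<And>x. f x * f x = (1::real)"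
      "\<And>x y. {x, y} \<in> E \<Longrightarrow> \<sigma> {x, y} = - \<mu> * f x * f y"
      using rank_le_one_imp_complete[OF _ edge, of \<mu>] rank by auto
    \<comment> \<open>Switching with \<open>s = - \<mu>\<close>: the two square roots of 1 separate
      the antibalanced and the balanced case.\<close>
    have sign: "cycle_sign \<sigma> c = (- \<mu>) ^ length c" if "is_cycle E c" for c
      using that f(3,4) by (rule cycle_sign_switching)
    from f(2) consider "\<mu> = 1" | "\<mu> = -1"
      by (metis square_eq_1_iff)
    then show ?thesis
    proof cases
      case 1
      then have "antibalanced E \<sigma>"
        using sign by (simp add: antibalanced_def minus_one_power_iff)
      then show ?thesis using f(1) 1 by blast
    next
      case 2
      then have "balanced E \<sigma>"
        using sign by (simp add: balanced_def)
      then show ?thesis using f(1) 2 by blast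
    qed
  next
    case 2
    have "\<mu> = 0"
      using extremal_eigenvalue_zero[OF assms 2] .
    then have r2: "rank (char_matrix 0) \<le> 2"
      using rank 2 by simp
    have g4: "4 \<le> girth E"
      using 2 by simp
    obtain X Y where XY: "X \<union> Y = UNIV" "X \<inter> Y = {}"
      "E = {{x, y} |x y. x \<in> X \<and> y \<in> Y}" "balanced E \<sigma>"
      by (rule rank_le_two_imp_bipartite[OF assms(1) g4 edge r2])
    have "complete_bipartite_graph E (card X) (card Y)"
      unfolding complete_bipartite_graph_def using XY(1-3) by blast
    \<comment> \<open>The 4-cycle alternates between the parts and so puts two vertices into
      each.\<close>
    then show ?thesis
      using \<open>\<mu> = 0\<close> XY(4) bipartite_parts_ge_two[OF XY(2,3) C(1)]
      by (intro disjI2 exI[of _ "card X"] exI[of _ "card Y"] conjI)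
  qed
qed

text \<open>Only an upper bound on the rank has to be found in each case;
  \<open>rank_ge_girth\<close> supplies the other inequality.\<close>

lemma extremal_imp_rank_eq:
  assumes "\<exists>c. is_cycle E c"
    and "(complete_graph E \<and> balanced E \<sigma> \<and> \<mu> = -1) \<or>
    (complete_graph E \<and> antibalanced E \<sigma> \<and> \<mu> = 1) \<or>
    (\<exists>n\<^sub>1 n\<^sub>2. n\<^sub>1 \<ge> 2 \<and> n\<^sub>2 \<ge> 2 \<and> complete_bipartite_graph E n\<^sub>1 n\<^sub>2 \<and> balanced E \<sigma> \<and> \<mu> = 0)"
  shows "rank (char_matrix \<mu>) = girth E - 2"
proof -
  have "rank (char_matrix \<mu>) \<le> girth E - 2"
    using assms(2)
  proof (elim disjE)
    assume *: "complete_graph E \<and> balanced E \<sigma> \<and> \<mu> = -1"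
    then have "rank (char_matrix \<mu>) \<le> 1"
      by (intro complete_imp_rank_le_one) (auto simp: balanced_def)
    then show ?thesis
      using complete_girth[OF _ assms(1)] * by simp
  next
    assume *: "complete_graph E \<and> antibalanced E \<sigma> \<and> \<mu> = 1"
    then have "rank (char_matrix \<mu>) \<le> 1"
      by (intro complete_imp_rank_le_one) (auto simp: antibalanced_def)
    then show ?thesis
      using complete_girth[OF _ assms(1)] * by simp
  next
    assume "\<exists>n\<^sub>1 n\<^sub>2. n\<^sub>1 \<ge> 2 \<and> n\<^sub>2 \<ge> 2 \<and> complete_bipartite_graph E n\<^sub>1 n\<^sub>2 \<and> balanced E \<sigma> \<and> \<mu> = 0"
    then obtain X Y where XY: "X \<union> Y = UNIV" "X \<inter> Y = {}" "E = {{x, y} |x y. x \<in> X \<and> y \<in> Y}"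
      "2 \<le> card X" "2 \<le> card Y" "balanced E \<sigma>" "\<mu> = 0"
      unfolding complete_bipartite_graph_def by blast
    from XY(4,5) have "X \<noteq> {}" "Y \<noteq> {}"
      by auto
    then obtain u v where "u \<in> X" "v \<in> Y"
      by blast
    then have "rank (char_matrix 0) \<le> 2"
      using XY(6) by (rule complete_bipartite_imp_rank_le_two[OF XY(1-3)])
    moreover have "girth E = 4"
      by (rule complete_bipartite_girth[OF XY(2-5)])
    ultimately show ?thesis
      using \<open>\<mu> = 0\<close> by simp
  qed
  then show ?thesis
    using rank_ge_girth[OF assms(1), of \<mu>] by simp
qed

corollary rank_eq_girth_minus_two_iff:
  assumes "connected_graph E" and "\<exists>c. is_cycle E c" and "girth E < CARD('v)"
  shows "rank (char_matrix \<mu>) = girth E - 2 \<longleftrightarrow>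
    (complete_graph E \<and> balanced E \<sigma> \<and> \<mu> = -1) \<or>
    (complete_graph E \<and> antibalanced E \<sigma> \<and> \<mu> = 1) \<or>
    (\<exists>n\<^sub>1 n\<^sub>2. n\<^sub>1 \<ge> 2 \<and> n\<^sub>2 \<ge> 2 \<and> complete_bipartite_graph E n\<^sub>1 n\<^sub>2 \<and> balanced E \<sigma> \<and> \<mu> = 0)"
  using rank_eq_imp_extremal[OF assms] extremal_imp_rank_eq[OF assms(2)] by (rule iffI)

end

theorem theorem3:
  fixes E :: "'v::finite set set" and \<sigma> :: "'v set \<Rightarrow> real" and \<mu> :: real
  assumes "signed_graph E \<sigma>"
    and "connected_graph E"
    and "CARD('v) \<ge> 3"
    and "\<exists>c. is_cycle E c"
    and "girth E < CARD('v)"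
    and "is_eigenvalue (adj_matrix E \<sigma>) \<mu>"
  shows "multiplicity_of (adj_matrix E \<sigma>) \<mu> \<le> CARD('v) - girth E + 2 \<and>
    (multiplicity_of (adj_matrix E \<sigma>) \<mu> = CARD('v) - girth E + 2 \<longleftrightarrow>
       (complete_graph E \<and> balanced E \<sigma> \<and> \<mu> = -1) \<or>
       (complete_graph E \<and> antibalanced E \<sigma> \<and> \<mu> = 1) \<or>
       (\<exists>n\<^sub>1 n\<^sub>2. n\<^sub>1 \<ge> 2 \<and> n\<^sub>2 \<ge> 2 \<and> complete_bipartite_graph E n\<^sub>1 n\<^sub>2 \<and> balanced E \<sigma> \<and> \<mu> = 0))"
proof -
  interpret signed_graph E \<sigma> by fact
  let ?M = "char_matrix \<mu>"
  have mult: "multiplicity_of (adj_matrix E \<sigma>) \<mu> = CARD('v) - rank ?M"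
    by (simp add: multiplicity_of_def char_matrix_def)
  have "rank ?M \<le> CARD('v)"
    using rank_bound[of ?M] by simp
  moreover have "girth E - 2 \<le> rank ?M"
    using assms(4) by (rule rank_ge_girth)
  moreover have "3 \<le> girth E"
    using assms(4) by (rule girth_ge_3)
  \<comment> \<open>The collected bounds ensure that none of the natural-number subtractions
    truncates.\<close>
  ultimately have le: "CARD('v) - rank ?M \<le> CARD('v) - girth E + 2"
    and eq: "CARD('v) - rank ?M = CARD('v) - girth E + 2 \<longleftrightarrow> rank ?M = girth E - 2"
    using assms(5) by linarith+
  then show ?thesis
    unfolding mult eq rank_eq_girth_minus_two_iff[OF assms(2,4,5)] by (intro conjI refl)
qed

end
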